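(* For every finite simple graph $G$, the edge-biclique hypergraph $\mathcal{EB}(G)$ is Helly if and only if the clique hypergraph $\mathcal{K}(L_G)$ of the biclique line graph $L_G$ is Helly.
   Context: A biclique of $G$ is a vertex set $B\subseteq V(G)$ such that $G[B]$ is a complete bipartite graph and $B$ is inclusion-wise maximal with this property. The edge-biclique hypergraph $\mathcal{EB}(G)$ has vertex set $E(G)$ and its hyperedges are the edge sets $E(G[B])$ of the bicliques $B$ of $G$. The biclique line graph $L_G$ has vertex set $E(G)$, two edges of $G$ being adjacent iff they are both edges of $G[B]$ for some biclique $B$ of $G$. The clique hypergraph $\mathcal{K}(H)$ of a graph $H$ has vertex set $V(H)$ and its hyperedges are the cliques (inclusion-wise maximal complete vertex sets) of $H$. A hypergraph is Helly if every subfamily of pairwise intersecting hyperedges has a nonempty common intersection. *)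

theory Defs
  imports "HOL-Library.Ramsey"
begin

text \<open>
  A hypergraph is a pair of a vertex set and a set of (hyper)edges. A simple graph is a hypergraph
  all of whose edges are two-element sets of vertices.
\<close>

type_synonym 'a hypergraph = "'a set \<times> 'a set set"

abbreviation verts :: "'a hypergraph \<Rightarrow> 'a set" where
  "verts H \<equiv> fst H"

abbreviation edges :: "'a hypergraph \<Rightarrow> 'a set set" where
  "edges H \<equiv> snd H"

definition finite_simple_graph :: "'a hypergraph \<Rightarrow> bool" where
  "finite_simple_graph G \<longleftrightarrow> finite (verts G) \<and> edges G \<subseteq> [verts G]\<^bsup>2\<^esup>"

definition induced_subgraph :: "'a hypergraph \<Rightarrow> 'a set \<Rightarrow> 'a hypergraph" where
  "induced_subgraph G B = (B, {e \<in> edges G. e \<subseteq> B})"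

text \<open>
  Both sides of a complete bipartite graph are nonempty, so that edgeless graphs are not
  complete bipartite and every biclique contains an edge.
\<close>

definition complete_bipartite :: "'a hypergraph \<Rightarrow> bool" where
  "complete_bipartite H \<longleftrightarrow>
     (\<exists>X Y. X \<noteq> {} \<and> Y \<noteq> {} \<and> X \<inter> Y = {} \<and> verts H = X \<union> Y \<and>
        edges H = {{x, y} | x y. x \<in> X \<and> y \<in> Y})"

definition biclique :: "'a hypergraph \<Rightarrow> 'a set \<Rightarrow> bool" where
  "biclique G B \<longleftrightarrow>
     B \<subseteq> verts G \<and> complete_bipartite (induced_subgraph G B) \<and>
     (\<forall>B'. B' \<subseteq> verts G \<longrightarrow> complete_bipartite (induced_subgraph G B') \<longrightarrow> B \<subseteq> B' \<longrightarrow> B' = B)"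

definition edge_biclique_hypergraph :: "'a hypergraph \<Rightarrow> 'a set hypergraph" where
  "edge_biclique_hypergraph G = (edges G, {edges (induced_subgraph G B) | B. biclique G B})"

definition biclique_line_graph :: "'a hypergraph \<Rightarrow> 'a set hypergraph" where
  "biclique_line_graph G =
     (edges G, {{e, f} | e f. e \<in> edges G \<and> f \<in> edges G \<and> e \<noteq> f \<and>
        (\<exists>B. biclique G B \<and> e \<in> edges (induced_subgraph G B) \<and> f \<in> edges (induced_subgraph G B))})"

text \<open>
  Here \<open>clique K E\<close> (from the Ramsey theory) only says that \<open>K\<close> is complete. Cliques proper are
  maximal, and nonempty; the latter only matters for the graph without vertices, whose clique
  hypergraph has no hyperedges.
\<close>

definition maximal_clique :: "'a hypergraph \<Rightarrow> 'a set \<Rightarrow> bool" where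
  "maximal_clique H K \<longleftrightarrow>
     K \<noteq> {} \<and> K \<subseteq> verts H \<and> clique K (edges H) \<and>
     (\<forall>K'. K' \<subseteq> verts H \<longrightarrow> clique K' (edges H) \<longrightarrow> K \<subseteq> K' \<longrightarrow> K' = K)"

definition clique_hypergraph :: "'a hypergraph \<Rightarrow> 'a hypergraph" where
  "clique_hypergraph H = (verts H, {K. maximal_clique H K})"

definition helly :: "'a hypergraph \<Rightarrow> bool" where
  "helly H \<longleftrightarrow>
     (\<forall>F. F \<subseteq> edges H \<longrightarrow> F \<noteq> {} \<longrightarrow> pairwise (\<lambda>A B. A \<inter> B \<noteq> {}) F \<longrightarrow> \<Inter>F \<noteq> {})"

end

theory Submission
  imports Defs
begin

text \<open>
  Two edges of \<open>G\<close> share a biclique iff their ends can be matched so that the union induces a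
  complete bipartite graph. A clique of \<open>L\<^sub>G\<close> lies in a biclique as soon as these matchings
  compose consistently around every three of its edges. An inconsistent triple contains a triangle
  of \<open>G\<close> whose three edges lie in three bicliques that intersect pairwise in edges of the triple.
  If either hypergraph is Helly, some edge \<open>xy\<close> then shares a biclique with each edge of the
  triangle, so \<open>x\<close> is adjacent to exactly one end of each of them, which is impossible by parity.
  Hence under either hypothesis the two hypergraphs coincide.
\<close>

text \<open>This is \<open>complete_bipartite\<close> for induced subgraphs, rewritten as conditions
  on single vertex pairs. Disjointness is implied: a common vertex \<open>v\<close> would make
  \<open>{v, v}\<close> both an edge and a non-edge.\<close>

definition bipartition :: "'a hypergraph \<Rightarrow> 'a set \<Rightarrow> 'a set \<Rightarrow> bool" where
  "bipartition G X Y \<longleftrightarrow> X \<noteq> {} \<and> Y \<noteq> {} \<and>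
     (\<forall>x\<in>X. \<forall>y\<in>Y. {x, y} \<in> edges G) \<and>
     (\<forall>x\<in>X. \<forall>x'\<in>X. {x, x'} \<notin> edges G) \<and> (\<forall>y\<in>Y. \<forall>y'\<in>Y. {y, y'} \<notin> edges G)"

text \<open>The arguments are oriented edges \<open>ab\<close> and \<open>cd\<close>:
  \<open>a\<close> and \<open>c\<close> lie on the same side. The two orientations of
  \<open>cd\<close> exclude each other, since one makes \<open>ac\<close> a non-edge and the other
  makes it an edge.\<close>

definition matched :: "'a hypergraph \<Rightarrow> 'a \<Rightarrow> 'a \<Rightarrow> 'a \<Rightarrow> 'a \<Rightarrow> bool" where
  "matched G a b c d \<longleftrightarrow> bipartition G {a, c} {b, d}"

text \<open>Going through \<open>cd\<close> puts \<open>a\<close> and \<open>x\<close> on the same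
  side; only the opposite matching of \<open>ab\<close> with \<open>xy\<close> is forbidden. Whether
  \<open>ab\<close> and \<open>xy\<close> share a biclique at all is left open.\<close>

definition matching_consistent :: "'a hypergraph \<Rightarrow> bool" where
  "matching_consistent G \<longleftrightarrow> (\<forall>a b c d x y.
     matched G a b c d \<longrightarrow> matched G c d x y \<longrightarrow> \<not> matched G a b y x)"

definition share_biclique :: "'a hypergraph \<Rightarrow> 'a set \<Rightarrow> 'a set \<Rightarrow> bool" where
  "share_biclique G e f \<longleftrightarrow> (\<exists>B. biclique G B \<and>
     e \<in> edges (induced_subgraph G B) \<and> f \<in> edges (induced_subgraph G B))"

section \<open>Bipartitions and bicliques of a finite simple graph\<close>

lemma edges_induced_subgraph [simp]:
  "e \<in> edges (induced_subgraph G B) \<longleftrightarrow> e \<in> edges G \<and> e \<subseteq> B"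
  by (simp add: induced_subgraph_def)

lemma finite_simple_graphD:
  assumes "finite_simple_graph G" "{x, y} \<in> edges G"
  shows "x \<noteq> y" "x \<in> verts G" "y \<in> verts G"
  using assms unfolding finite_simple_graph_def nsets_def by auto

lemma edgeE:
  assumes "finite_simple_graph G" "e \<in> edges G"
  obtains x y where "e = {x, y}" "x \<noteq> y"
proof -
  have "card e = 2" using assms unfolding finite_simple_graph_def nsets_def by auto
  then show thesis using that by (auto simp: card_2_iff)
qed

lemma finite_edges:
  assumes "finite_simple_graph G"
  shows "finite (edges G)"
  using assms unfolding finite_simple_graph_def
  by (meson finite_imp_finite_nsets finite_subset)

lemma bipartition_commute: "bipartition G X Y \<longleftrightarrow> bipartition G Y X"
proof -
  have "{x, y} \<in> edges G \<longleftrightarrow> {y, x} \<in> edges G" for x y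
    by (simp add: insert_commute)
  then show ?thesis unfolding bipartition_def by blast
qed

lemma bipartition_subset:
  assumes "bipartition G X Y" "X' \<subseteq> X" "Y' \<subseteq> Y" "X' \<noteq> {}" "Y' \<noteq> {}"
  shows "bipartition G X' Y'"
  using assms unfolding bipartition_def by (simp add: subset_eq)

lemma matchedD:
  assumes "matched G a b c d"
  shows "{a, d} \<in> edges G" "{a, c} \<notin> edges G" "{b, d} \<notin> edges G"
  using assms unfolding matched_def bipartition_def by auto

lemma matched_swap: "matched G a b c d \<longleftrightarrow> matched G b a d c"
  unfolding matched_def by (rule bipartition_commute)

lemma complete_bipartite_induced_iff:
  assumes G: "finite_simple_graph G"
  shows "complete_bipartite (induced_subgraph G B) \<longleftrightarrow> (\<exists>X Y. B = X \<union> Y \<and> bipartition G X Y)"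
proof
  assume "complete_bipartite (induced_subgraph G B)"
  then obtain X Y where XY: "X \<noteq> {}" "Y \<noteq> {}" "X \<inter> Y = {}" "B = X \<union> Y"
    and E: "edges (induced_subgraph G B) = {{x, y} | x y. x \<in> X \<and> y \<in> Y}"
    unfolding complete_bipartite_def by (auto simp: induced_subgraph_def)
  have iff: "e \<in> edges G \<and> e \<subseteq> B \<longleftrightarrow> (\<exists>x y. e = {x, y} \<and> x \<in> X \<and> y \<in> Y)" for e
    using E unfolding set_eq_iff by auto
  have "{x, y} \<in> edges G" if "x \<in> X" "y \<in> Y" for x y
    using iff[of "{x, y}"] that by blast
  moreover have "{x, x'} \<notin> edges G" if "x \<in> X" "x' \<in> X" for x x'
    using iff[of "{x, x'}"] that XY by (auto simp: doubleton_eq_iff)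
  moreover have "{y, y'} \<notin> edges G" if "y \<in> Y" "y' \<in> Y" for y y'
    using iff[of "{y, y'}"] that XY by (auto simp: doubleton_eq_iff)
  ultimately show "\<exists>X Y. B = X \<union> Y \<and> bipartition G X Y"
    using XY unfolding bipartition_def by (intro exI[of _ X] exI[of _ Y] conjI ballI)
next
  assume "\<exists>X Y. B = X \<union> Y \<and> bipartition G X Y"
  then obtain X Y where B: "B = X \<union> Y" and XY: "bipartition G X Y" by blast
  have "X \<inter> Y = {}"
    using XY finite_simple_graphD(1)[OF G] unfolding bipartition_def by blast
  moreover have "edges (induced_subgraph G B) = {{x, y} | x y. x \<in> X \<and> y \<in> Y}"
  proof (intro equalityI subsetI)
    fix e assume e: "e \<in> edges (induced_subgraph G B)"
    then have "e \<in> edges G" by simp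
    then obtain u v where uv: "e = {u, v}" using edgeE[OF G] by blast
    then have "u \<in> X \<and> v \<in> Y \<or> v \<in> X \<and> u \<in> Y"
      using e B XY unfolding bipartition_def by auto
    then show "e \<in> {{x, y} | x y. x \<in> X \<and> y \<in> Y}"
      using uv by (auto simp: insert_commute)
  next
    fix e assume "e \<in> {{x, y} | x y. x \<in> X \<and> y \<in> Y}"
    then show "e \<in> edges (induced_subgraph G B)"
      using B XY unfolding bipartition_def by auto
  qed
  ultimately show "complete_bipartite (induced_subgraph G B)"
    using B XY unfolding complete_bipartite_def bipartition_def
    by (intro exI[of _ X] exI[of _ Y]) (simp add: induced_subgraph_def)
qed

lemma bicliqueE:
  assumes "finite_simple_graph G" "biclique G B"
  obtains X Y where "B = X \<union> Y" "bipartition G X Y"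
proof -
  have "complete_bipartite (induced_subgraph G B)" using assms(2) by (simp add: biclique_def)
  then show thesis using that unfolding complete_bipartite_induced_iff[OF assms(1)] by blast
qed

text \<open>By finiteness an induced complete bipartite subgraph extends to a maximal one. To show
  that edges share a biclique it therefore suffices to find a bipartition containing them.\<close>

lemma bipartition_subset_biclique:
  assumes G: "finite_simple_graph G" and XY: "bipartition G X Y"
  obtains B where "biclique G B" "X \<union> Y \<subseteq> B"
proof -
  let ?\<B> = "{B. B \<subseteq> verts G \<and> complete_bipartite (induced_subgraph G B)}"
  have "finite ?\<B>"
    using G unfolding finite_simple_graph_def by (auto intro: finite_subset[of _ "Pow (verts G)"])
  moreover have "X \<union> Y \<subseteq> verts G"
    using XY finite_simple_graphD[OF G] unfolding bipartition_def by blast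
  then have "X \<union> Y \<in> ?\<B>"
    using XY complete_bipartite_induced_iff[OF G] by blast
  ultimately obtain B where "B \<in> ?\<B>" "X \<union> Y \<subseteq> B" "\<forall>B'\<in>?\<B>. B \<subseteq> B' \<longrightarrow> B = B'"
    using finite_has_maximal2[of ?\<B> "X \<union> Y"] by blast
  then have "biclique G B" unfolding biclique_def by auto
  then show thesis using \<open>X \<union> Y \<subseteq> B\<close> by (rule that)
qed

text \<open>Both sides are nonempty, so no vertex of \<open>B\<close> is isolated. Hence inclusions
  between edge sets of bicliques carry over to the bicliques, where maximality applies.\<close>

lemma Union_edges_biclique:
  assumes "finite_simple_graph G" "biclique G B"
  shows "\<Union>(edges (induced_subgraph G B)) = B"
proof
  obtain X Y where "B = X \<union> Y" "bipartition G X Y"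
    using bicliqueE[OF assms] .
  then have "\<exists>w\<in>B. {v, w} \<in> edges G" if "v \<in> B" for v
    using that unfolding bipartition_def by (metis UnE UnI1 UnI2 ex_in_conv insert_commute)
  then show "B \<subseteq> \<Union>(edges (induced_subgraph G B))"
    by (auto simp: induced_subgraph_def)
qed auto

lemma edges_biclique_nonempty:
  assumes "finite_simple_graph G" "biclique G B"
  shows "edges (induced_subgraph G B) \<noteq> {}"
proof -
  obtain X Y where "B = X \<union> Y" "bipartition G X Y"
    using bicliqueE[OF assms] .
  then have "B \<noteq> {}" by (simp add: bipartition_def)
  then show ?thesis using Union_edges_biclique[OF assms] by auto
qed

section \<open>Edges that share a biclique\<close>

lemma share_biclique_matched:
  assumes G: "finite_simple_graph G" and "share_biclique G {a, b} {c, d}"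
  shows "matched G a b c d \<or> matched G a b d c"
proof -
  obtain B where B: "biclique G B" and *: "{a, b} \<in> edges G" "{c, d} \<in> edges G"
    "{a, b, c, d} \<subseteq> B"
    using assms(2) unfolding share_biclique_def by auto
  obtain X Y where XY: "B = X \<union> Y" "bipartition G X Y"
    using bicliqueE[OF G B] .
  have *: "a \<in> X \<and> b \<in> Y \<or> a \<in> Y \<and> b \<in> X" "c \<in> X \<and> d \<in> Y \<or> c \<in> Y \<and> d \<in> X"
    using * XY unfolding bipartition_def by auto
  \<comment> \<open>The second conjunct exchanges the two sides; it serves the cases where
    \<open>a\<close> lies in \<open>Y\<close>.\<close>
  have sides: "matched G u v w z \<and> matched G v u z w"
    if "u \<in> X" "w \<in> X" "v \<in> Y" "z \<in> Y" for u v w z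
    using bipartition_subset[OF XY(2), of "{u, w}" "{v, z}"] that
    by (simp add: matched_def bipartition_commute[of G "{v, z}"])
  show ?thesis
    using * sides by blast
qed

lemma share_biclique_refl:
  assumes G: "finite_simple_graph G" and e: "e \<in> edges G"
  shows "share_biclique G e e"
proof -
  obtain x y where xy: "e = {x, y}" using edgeE[OF G e] by blast
  have "{v, v} \<notin> edges G" for v
    using finite_simple_graphD(1)[OF G] by blast
  then have "bipartition G {x} {y}"
    using e xy unfolding bipartition_def by auto
  then obtain B where "biclique G B" "{x} \<union> {y} \<subseteq> B"
    using bipartition_subset_biclique[OF G] by blast
  then show ?thesis
    using e xy unfolding share_biclique_def by auto
qed

section \<open>Triangles and the Helly property\<close>

lemma not_share_biclique_triangle:
  assumes G: "finite_simple_graph G"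
    and "share_biclique G e {a, b}" "share_biclique G e {b, c}" "share_biclique G e {a, c}"
  shows False
proof -
  have "e \<in> edges G" using assms(2) by (auto simp: share_biclique_def)
  then obtain x y where e: "e = {x, y}" using edgeE[OF G] by blast
  \<comment> \<open>Adjacency to \<open>x\<close> separates the ends of every edge sharing a
    biclique with \<open>e\<close>. For the three given edges it would be a proper 2-colouring of a
    triangle.\<close>
  have "{x, u} \<in> edges G \<longleftrightarrow> {x, v} \<notin> edges G" if "share_biclique G e {u, v}" for u v
    using share_biclique_matched[OF G that[unfolded e]]
    unfolding matched_def bipartition_def by auto
  then show False using assms(2-4) by blast
qed

text \<open>\<open>H\<close> is kept abstract so that the argument serves both hypergraphs: the edge
  sets of bicliques extend to hyperedges, and members of a hyperedge share bicliques
  pairwise.\<close>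

lemma helly_imp_matching_consistent:
  assumes G: "finite_simple_graph G" and H: "helly H"
    and extend: "\<And>B. biclique G B \<Longrightarrow> \<exists>h\<in>edges H. edges (induced_subgraph G B) \<subseteq> h"
    and share: "\<And>h e f. h \<in> edges H \<Longrightarrow> e \<in> h \<Longrightarrow> f \<in> h \<Longrightarrow> share_biclique G e f"
  shows "matching_consistent G"
  unfolding matching_consistent_def
proof (intro allI impI notI)
  fix a b c d x y
  assume m: "matched G a b c d" "matched G c d x y" "matched G a b y x"
  have hyperedge: "\<exists>h\<in>edges H. {u, v} \<in> h \<and> {w, z} \<in> h \<and> {u, z} \<in> h"
    if "matched G u v w z" for u v w z
  proof -
    obtain B where "biclique G B" "{u, w} \<union> {v, z} \<subseteq> B"
      using bipartition_subset_biclique[OF G] \<open>matched G u v w z\<close> unfolding matched_def by blast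
    moreover have "{u, v} \<in> edges G" "{w, z} \<in> edges G" "{u, z} \<in> edges G"
      using that unfolding matched_def bipartition_def by auto
    ultimately have "{{u, v}, {w, z}, {u, z}} \<subseteq> edges (induced_subgraph G B)"
      and "\<exists>h\<in>edges H. edges (induced_subgraph G B) \<subseteq> h"
      using extend by auto
    then show ?thesis by blast
  qed
  obtain h\<^sub>1 where h1: "h\<^sub>1 \<in> edges H" "{a, b} \<in> h\<^sub>1" "{c, d} \<in> h\<^sub>1" "{a, d} \<in> h\<^sub>1"
    using hyperedge[OF m(1)] by blast
  \<comment> \<open>Reversing both edges makes \<open>hyperedge\<close> deliver \<open>dx\<close> as
    its cross edge. Together with \<open>ad\<close> and \<open>ax\<close> from the other two
    matchings, it closes the triangle on \<open>a\<close>, \<open>d\<close>,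
    \<open>x\<close>.\<close>
  have "matched G d c y x"
    using m(2) by (rule iffD1[OF matched_swap])
  then obtain h\<^sub>2 where h2: "h\<^sub>2 \<in> edges H" "{c, d} \<in> h\<^sub>2" "{x, y} \<in> h\<^sub>2" "{d, x} \<in> h\<^sub>2"
    using hyperedge[of d c y x] unfolding insert_commute[of d c] insert_commute[of y x] by blast
  obtain h\<^sub>3 where h3: "h\<^sub>3 \<in> edges H" "{a, b} \<in> h\<^sub>3" "{x, y} \<in> h\<^sub>3" "{a, x} \<in> h\<^sub>3"
    using hyperedge[OF m(3)] unfolding insert_commute[of y x] by blast
  \<comment> \<open>The common elements of the three pairs are \<open>cd\<close>, \<open>xy\<close>
    and \<open>ab\<close>.\<close>
  have "pairwise (\<lambda>A B. A \<inter> B \<noteq> {}) {h\<^sub>1, h\<^sub>2, h\<^sub>3}"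
    using h1 h2 h3 unfolding pairwise_def by blast
  then have "\<Inter>{h\<^sub>1, h\<^sub>2, h\<^sub>3} \<noteq> {}"
    using H[unfolded helly_def, rule_format, of "{h\<^sub>1, h\<^sub>2, h\<^sub>3}"] h1(1) h2(1) h3(1) by simp
  then obtain e where "e \<in> h\<^sub>1" "e \<in> h\<^sub>2" "e \<in> h\<^sub>3" by blast
  then show False
    using not_share_biclique_triangle[OF G share[OF h1(1)] share[OF h2(1)] share[OF h3(1)]]
      h1(4) h2(4) h3(4) by blast
qed

section \<open>Cliques of the biclique line graph\<close>

lemma clique_biclique_line_graph_iff:
  assumes G: "finite_simple_graph G" and K: "K \<subseteq> edges G"
  shows "clique K (edges (biclique_line_graph G)) \<longleftrightarrow> (\<forall>e\<in>K. \<forall>f\<in>K. share_biclique G e f)"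
proof -
  have adjacent: "{e, f} \<in> edges (biclique_line_graph G) \<longleftrightarrow> e \<noteq> f \<and> share_biclique G e f" for e f
  proof
    assume "{e, f} \<in> edges (biclique_line_graph G)"
    then obtain e' f' where "{e, f} = {e', f'}" "e' \<noteq> f'" "share_biclique G e' f'"
      unfolding biclique_line_graph_def share_biclique_def snd_conv mem_Collect_eq by metis
    then show "e \<noteq> f \<and> share_biclique G e f"
      unfolding share_biclique_def doubleton_eq_iff by metis
  next
    assume "e \<noteq> f \<and> share_biclique G e f"
    then show "{e, f} \<in> edges (biclique_line_graph G)"
      unfolding biclique_line_graph_def share_biclique_def snd_conv mem_Collect_eq
      by (intro exI[of _ e] exI[of _ f]) auto
  qed
  \<comment> \<open>\<open>clique\<close> constrains only distinct elements, so the diagonal is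
    supplied separately.\<close>
  have "share_biclique G e e" if "e \<in> K" for e
    using share_biclique_refl[OF G] K that by auto
  then show ?thesis
    unfolding clique_def adjacent by metis
qed

lemma clique_edges_biclique:
  assumes "finite_simple_graph G" "biclique G B"
  shows "clique (edges (induced_subgraph G B)) (edges (biclique_line_graph G))"
proof -
  have "edges (induced_subgraph G B) \<subseteq> edges G" by auto
  then show ?thesis
    using assms unfolding clique_biclique_line_graph_iff[OF assms(1) \<open>_ \<subseteq> _\<close>]
    by (auto simp: share_biclique_def)
qed

lemma clique_subset_maximal_clique:
  assumes "finite (verts H)" "K \<noteq> {}" "K \<subseteq> verts H" "clique K (edges H)"
  obtains M where "maximal_clique H M" "K \<subseteq> M"
proof -
  let ?\<K> = "{K. K \<subseteq> verts H \<and> clique K (edges H)}"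
  have "finite ?\<K>"
    using assms(1) by (auto intro: finite_subset[of _ "Pow (verts H)"])
  moreover have "K \<in> ?\<K>" using assms by blast
  ultimately obtain M where "M \<in> ?\<K>" "K \<subseteq> M" "\<forall>K'\<in>?\<K>. M \<subseteq> K' \<longrightarrow> M = K'"
    using finite_has_maximal2[of ?\<K> K] by blast
  then have "maximal_clique H M" using assms(2) unfolding maximal_clique_def by auto
  then show thesis using \<open>K \<subseteq> M\<close> by (rule that)
qed

section \<open>Comparison of the two hypergraphs\<close>

lemma verts_biclique_line_graph [simp]: "verts (biclique_line_graph G) = edges G"
  by (simp add: biclique_line_graph_def)

lemma helly_edge_biclique_imp_matching_consistent:
  assumes "finite_simple_graph G" "helly (edge_biclique_hypergraph G)"
  shows "matching_consistent G"
  using assms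
  by (rule helly_imp_matching_consistent)
    (auto simp: edge_biclique_hypergraph_def share_biclique_def)

lemma helly_clique_imp_matching_consistent:
  assumes G: "finite_simple_graph G" and "helly (clique_hypergraph (biclique_line_graph G))"
  shows "matching_consistent G"
  using assms
proof (rule helly_imp_matching_consistent)
  fix B assume B: "biclique G B"
  have sub: "edges (induced_subgraph G B) \<subseteq> verts (biclique_line_graph G)"
    by auto
  \<comment> \<open>Consistency is not yet known here, so \<open>M\<close> may be strictly larger
    than the edge set of \<open>B\<close>.\<close>
  obtain M where "maximal_clique (biclique_line_graph G) M" "edges (induced_subgraph G B) \<subseteq> M"
    using clique_subset_maximal_clique[OF _ edges_biclique_nonempty[OF G B] sub
        clique_edges_biclique[OF G B]] finite_edges[OF G] by auto
  then show "\<exists>h\<in>edges (clique_hypergraph (biclique_line_graph G)).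
      edges (induced_subgraph G B) \<subseteq> h"
    by (auto simp: clique_hypergraph_def)
next
  fix h e f
  assume "h \<in> edges (clique_hypergraph (biclique_line_graph G))" "e \<in> h" "f \<in> h"
  then show "share_biclique G e f"
    using clique_biclique_line_graph_iff[OF G, of h]
    by (auto simp: clique_hypergraph_def maximal_clique_def)
qed

text \<open>Fixing one edge \<open>ab\<close> of \<open>K\<close> orients all the others, and
  consistency makes these orientations agree pairwise. The ends on the side of \<open>a\<close> and
  those on the side of \<open>b\<close> then form a bipartition.\<close>

lemma clique_subset_biclique:
  assumes G: "finite_simple_graph G" and con: "matching_consistent G"
    and K: "K \<noteq> {}" "K \<subseteq> edges G" "clique K (edges (biclique_line_graph G))"
  obtains B where "biclique G B" "K \<subseteq> edges (induced_subgraph G B)"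
proof -
  have share: "share_biclique G e f" if "e \<in> K" "f \<in> K" for e f
    using K clique_biclique_line_graph_iff[OF G] that by blast
  obtain e where e: "e \<in> K" using K(1) by blast
  obtain a b where ab: "e = {a, b}" using edgeE[OF G] e K(2) by blast
  define X where "X = {x. \<exists>y. matched G a b x y \<and> {x, y} \<in> K}"
  define Y where "Y = {y. \<exists>x. matched G a b x y \<and> {x, y} \<in> K}"
  \<comment> \<open>The two edges share a biclique, so they match in one of two ways. The wrong way
    would be an inconsistent triple with \<open>ab\<close>.\<close>
  have matched_K: "matched G x y x' y'"
    if "matched G a b x y" "{x, y} \<in> K" "matched G a b x' y'" "{x', y'} \<in> K" for x y x' y'
    using share_biclique_matched[OF G share[OF that(2,4)]] con that(1,3)
    unfolding matching_consistent_def by blast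
  have cover: "\<exists>x\<in>X. \<exists>y\<in>Y. f = {x, y}" if f: "f \<in> K" for f
  proof -
    obtain c d where cd: "f = {c, d}" using edgeE[OF G] f K(2) by blast
    have "matched G a b c d \<or> matched G a b d c"
      using share_biclique_matched[OF G] share[OF e f] ab cd by blast
    then obtain x y where xy: "f = {x, y}" "matched G a b x y"
      using cd insert_commute[of c d] by metis
    then have "x \<in> X" "y \<in> Y" using f unfolding X_def Y_def by auto
    then show ?thesis using xy(1) by blast
  qed
  have "bipartition G X Y"
    unfolding bipartition_def
  proof (intro conjI ballI)
    show "X \<noteq> {}" "Y \<noteq> {}" using cover[OF e] by auto
  next
    fix x y assume "x \<in> X" "y \<in> Y"
    then show "{x, y} \<in> edges G"
      using matchedD(1)[OF matched_K] unfolding X_def Y_def by auto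
  next
    fix x x' assume "x \<in> X" "x' \<in> X"
    then show "{x, x'} \<notin> edges G"
      using matchedD(2)[OF matched_K] unfolding X_def by auto
  next
    fix y y' assume "y \<in> Y" "y' \<in> Y"
    then show "{y, y'} \<notin> edges G"
      using matchedD(3)[OF matched_K] unfolding Y_def by auto
  qed
  then obtain B where B: "biclique G B" "X \<union> Y \<subseteq> B"
    using bipartition_subset_biclique[OF G] by blast
  moreover have "f \<in> edges (induced_subgraph G B)" if "f \<in> K" for f
    using cover[OF that] that B(2) K(2) by auto
  ultimately show thesis using that by blast
qed

lemma edge_biclique_hypergraph_eq_clique_hypergraph:
  assumes G: "finite_simple_graph G" and con: "matching_consistent G"
  shows "edge_biclique_hypergraph G = clique_hypergraph (biclique_line_graph G)"
proof -
  let ?L = "biclique_line_graph G"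
  have "maximal_clique ?L (edges (induced_subgraph G B))" if B: "biclique G B" for B
    unfolding maximal_clique_def
  proof (intro conjI allI impI)
    show "edges (induced_subgraph G B) \<noteq> {}" by (rule edges_biclique_nonempty[OF G B])
    show "edges (induced_subgraph G B) \<subseteq> verts ?L" by auto
    show "clique (edges (induced_subgraph G B)) (edges ?L)" by (rule clique_edges_biclique[OF G B])
  next
    fix K assume K: "K \<subseteq> verts ?L" "clique K (edges ?L)" "edges (induced_subgraph G B) \<subseteq> K"
    have "K \<noteq> {}" using K(3) edges_biclique_nonempty[OF G B] by blast
    then obtain B' where B': "biclique G B'" "K \<subseteq> edges (induced_subgraph G B')"
      using clique_subset_biclique[OF G con] K by auto
    \<comment> \<open>Maximality of a biclique concerns vertex sets, so the inclusion of edge sets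
      is first turned into one of vertex sets.\<close>
    then have "B \<subseteq> B'"
      using K(3) Union_edges_biclique[OF G B] Union_edges_biclique[OF G B'(1)] by blast
    then have "B' = B" using B B'(1) unfolding biclique_def by blast
    then show "K = edges (induced_subgraph G B)" using B'(2) K(3) by blast
  qed
  moreover have "\<exists>B. K = edges (induced_subgraph G B) \<and> biclique G B" if "maximal_clique ?L K" for K
  proof -
    obtain B where B: "biclique G B" "K \<subseteq> edges (induced_subgraph G B)"
      using clique_subset_biclique[OF G con] \<open>maximal_clique ?L K\<close>
      unfolding maximal_clique_def by auto
    moreover have "edges (induced_subgraph G B) \<subseteq> verts ?L" by auto
    \<comment> \<open>The edge set of \<open>B\<close> is itself complete in \<open>?L\<close>, so
      maximality of \<open>K\<close> forces equality.\<close>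
    ultimately have "edges (induced_subgraph G B) = K"
      using that clique_edges_biclique[OF G B(1)] unfolding maximal_clique_def by blast
    then show ?thesis using B(1) by blast
  qed
  ultimately show ?thesis
    unfolding edge_biclique_hypergraph_def clique_hypergraph_def by auto
qed

theorem theorem8:
  fixes G :: "'a hypergraph"
  assumes "finite_simple_graph G"
  shows "helly (edge_biclique_hypergraph G) \<longleftrightarrow>
         helly (clique_hypergraph (biclique_line_graph G))"
  using assms edge_biclique_hypergraph_eq_clique_hypergraph
    helly_edge_biclique_imp_matching_consistent helly_clique_imp_matching_consistent
  by metis

end
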